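(* Fix a mode theory $\mathcal{M}$ (a strict 2-category) and consider the multimodal $\lambda$-calculus and the partial operation $M\{\Gamma,\alpha,\Delta\}$ described in the context. For all pre-contexts $\Gamma,\Delta$, parallel modalities $\mu,\nu:n\to m$, transformation $\alpha:\mu\Rightarrow\nu$, mode $p$, term $M$ and type $A$: if $\Gamma.\mathsf{lock}_\mu,\Delta\vdash M : A\ @\,p$ is derivable, then $M\{\Gamma,\alpha,\Delta\}$ is defined and $\Gamma.\mathsf{lock}_\nu,\Delta\vdash M\{\Gamma,\alpha,\Delta\} : A\ @\,p$ is derivable.
   Context: A mode theory is a strict 2-category $\mathcal{M}$: objects are modes; 1-cells $\mu:n\to m$ are modalities, with composition $\mu\circ\nu$ and identities $1_m$; 2-cells $\alpha:\mu\Rightarrow\nu$ between parallel modalities are transformations, with vertical composition $\beta\circ\alpha$, identities $1_\mu$ and horizontal composition $\alpha*\beta:\mu\circ\theta\Rightarrow\nu\circ\xi$ for $\alpha:\mu\Rightarrow\nu$, $\beta:\theta\Rightarrow\xi$, obeying the strict 2-category laws. Types: pre-types $A,B ::= p_i \mid \bot \mid \top \mid A+B \mid A\times B \mid (\mu\mid A)\to B \mid \langle\mu\mid A\rangle$; "$A$ type $@\,m$" is generated by: $p_i,\top,\bot$ are types at every mode; $A\times B$, $A+B$ type $@\,m$ if $A,B$ type $@\,m$; $(\mu\mid A)\to B$ type $@\,m$ if $\mu:n\to m$, $A$ type $@\,n$, $B$ type $@\,m$; $\langle\mu\mid A\rangle$ type $@\,m$ if $A$ type $@\,n$ and $\mu:n\to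 m$. Contexts: pre-contexts $\Gamma ::= \cdot \mid \Gamma, x:(\mu\mid A)\mid \Gamma.\mathsf{lock}_\mu$; "$\Gamma$ ctx $@\,m$" is generated by: $\cdot$ ctx $@\,m$; $\Gamma, x:(\mu\mid A)$ ctx $@\,m$ if $\Gamma$ ctx $@\,m$, $A$ type $@\,n$, $\mu:n\to m$, $x$ fresh; $\Gamma.\mathsf{lock}_\mu$ ctx $@\,n$ if $\Gamma$ ctx $@\,m$ and $\mu:n\to m$. Contexts are identified modulo $\Gamma.\mathsf{lock}_{1_m}=\Gamma$ and $\Gamma.\mathsf{lock}_\mu.\mathsf{lock}_\nu=\Gamma.\mathsf{lock}_{\mu\circ\nu}$. $\Gamma,\Delta$ is concatenation. Define $|\cdot|=1$, $|\Gamma,x:(\mu\mid A)|=|\Gamma|$, $|\Gamma.\mathsf{lock}_\mu|=|\Gamma|\circ\mu$. Typing judgement $\Gamma\vdash M:A\ @\,m$ generated by (premises at mode $m$ unless indicated; bound variables up to capture-avoiding renaming): (var) if $\mu:n\to m$ and $\alpha:\mu\Rightarrow|\Delta|$ then $\Gamma, x:(\mu\mid A),\Delta\vdash x_\alpha : A\ @\,n$; (pair) from $M:A$, $N:B$ infer $\langle M,N\rangle : A\times B$; (proj) from $P:A_1\times A_2$ infer $\pi_i(P):A_i$; (lam) from $\Gamma,x:(\mu\mid A)\vdash M:B$ infer $\Gamma\vdash\lambda x.M : (\mu\mid A)\to B$; (app) if $\mu:n\to m$, from $\Gamma\vdash M:(\mu\mid A)\to B\ @\,m$ and $\Gamma.\mathsf{lock}_\mu\vdash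 N:A\ @\,n$ infer $\Gamma\vdash M\,@_\mu N : B\ @\,m$; (inj) from $M:A_i$ infer $\mathsf{in}_i(M):A_1+A_2$; (case) from $\Gamma\vdash M:A+B$, $\Gamma,x:(1\mid A)\vdash P:C$, $\Gamma,y:(1\mid B)\vdash Q:C$ infer $\Gamma\vdash\mathsf{case}\ M\ \mathsf{of}\ (x.P;\ y.Q):C$; (mod) if $\mu:n\to m$, from $\Gamma.\mathsf{lock}_\mu\vdash M:A\ @\,n$ infer $\Gamma\vdash\mathsf{mod}_\mu(M):\langle\mu\mid A\rangle\ @\,m$; (let) if $\nu:o\to n$, $\mu:n\to m$, from $\Gamma.\mathsf{lock}_\mu\vdash M:\langle\nu\mid A\rangle\ @\,n$ and $\Gamma,x:(\mu\circ\nu\mid A)\vdash N:B\ @\,m$ infer $\Gamma\vdash\mathsf{let}_\mu\ \mathsf{mod}_\nu(x)=M\ \mathsf{in}\ N : B\ @\,m$. Lock-weakening operation. For a 2-cell $\alpha$ and disjoint pre-contexts $\Gamma,\Delta$, the partial operation $M\{\Gamma,\alpha,\Delta\}$ is defined by recursion on $M$: - if $\Gamma = \Gamma_0, x:(\rho\mid A), \Gamma'$, then $x_{\alpha'}\{\Gamma,\alpha,\Delta\} = x_{(1_{|\Gamma'|} * \alpha * 1_{|\Delta|})\circ\alpha'}$; - if $\Delta = \Delta_0, x:(\rho\mid A),\Delta'$, then $x_{\alpha'}\{\Gamma,\alpha,\Delta\} = x_{\alpha'}$; - $(\lambda x.M)\{\Gamma,\alpha,\Delta\} = \lambda x.\,M\{\Gamma,\alpha,(\Delta,x:(\xi\mid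 A))\}$ where $x$ is bound with tag $\xi$ and type $A$; - $(M\,@_\xi N)\{\Gamma,\alpha,\Delta\} = M\{\Gamma,\alpha,\Delta\}\,@_\xi\,N\{\Gamma,\alpha,\Delta.\mathsf{lock}_\xi\}$; - $\mathsf{mod}_\xi(M)\{\Gamma,\alpha,\Delta\} = \mathsf{mod}_\xi(M\{\Gamma,\alpha,\Delta.\mathsf{lock}_\xi\})$; - $\langle M,N\rangle$, $\pi_i(M)$, $\mathsf{in}_i(M)$: apply the operation with the same parameters to the immediate subterms; - $(\mathsf{let}_\rho\ \mathsf{mod}_\xi(x)=M\ \mathsf{in}\ N)\{\Gamma,\alpha,\Delta\} = \mathsf{let}_\rho\ \mathsf{mod}_\xi(x)=M\{\Gamma,\alpha,\Delta.\mathsf{lock}_\rho\}\ \mathsf{in}\ N\{\Gamma,\alpha,(\Delta,x:(\rho\circ\xi\mid A))\}$; - $(\mathsf{case}\ M\ \mathsf{of}\ (x.P;y.Q))\{\Gamma,\alpha,\Delta\} = \mathsf{case}\ M\{\Gamma,\alpha,\Delta\}\ \mathsf{of}\ (x.P\{\Gamma,\alpha,(\Delta,x:(1\mid A))\};\ y.Q\{\Gamma,\alpha,(\Delta,y:(1\mid B))\})$. It is undefined when no clause applies (e.g. a variable declared in neither $\Gamma$ nor $\Delta$, or an ill-typed composite 2-cell). *)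

theory Defs
  imports Main
begin

text \<open>
  The objects, 1-cells and 2-cells of a mode theory are the elements of the sets \<open>modes\<close>,
  \<open>modalities\<close> and \<open>transformations\<close>.  The operations are total functions that are only constrained
  on composable arguments; \<open>\<mu> \<odot>\<^bsub>M\<^esub> \<nu>\<close> is composition of modalities, \<open>\<beta> \<cdot>\<^bsub>M\<^esub> \<alpha>\<close> vertical and
  \<open>\<alpha> \<star>\<^bsub>M\<^esub> \<beta>\<close> horizontal composition of transformations, all in applicative order.
\<close>

record ('o, 'a, 't) mode_theory =
  modes :: "'o set"
  modalities :: "'a set"
  transformations :: "'t set"
  src :: "'a \<Rightarrow> 'o"
  tgt :: "'a \<Rightarrow> 'o"
  id_mod :: "'o \<Rightarrow> 'a"
  comp_mod :: "'a \<Rightarrow> 'a \<Rightarrow> 'a"  (infixl "\<odot>\<index>" 70)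
  dom_tr :: "'t \<Rightarrow> 'a"
  cod_tr :: "'t \<Rightarrow> 'a"
  id_tr :: "'a \<Rightarrow> 't"
  vcomp :: "'t \<Rightarrow> 't \<Rightarrow> 't"  (infixl "\<cdot>\<index>" 70)
  hcomp :: "'t \<Rightarrow> 't \<Rightarrow> 't"  (infixl "\<star>\<index>" 75)

definition modality :: "('o, 'a, 't) mode_theory \<Rightarrow> 'a \<Rightarrow> 'o \<Rightarrow> 'o \<Rightarrow> bool" where
  "modality M \<mu> n m \<longleftrightarrow> \<mu> \<in> modalities M \<and> src M \<mu> = n \<and> tgt M \<mu> = m"

definition transformation :: "('o, 'a, 't) mode_theory \<Rightarrow> 't \<Rightarrow> 'a \<Rightarrow> 'a \<Rightarrow> bool" where
  "transformation M \<alpha> \<mu> \<nu> \<longleftrightarrow> \<alpha> \<in> transformations M \<and> dom_tr M \<alpha> = \<mu> \<and> cod_tr M \<alpha> = \<nu>"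

definition composable :: "('o, 'a, 't) mode_theory \<Rightarrow> 'a \<Rightarrow> 'a \<Rightarrow> bool" where
  "composable M \<mu> \<nu> \<longleftrightarrow> \<mu> \<in> modalities M \<and> \<nu> \<in> modalities M \<and> src M \<mu> = tgt M \<nu>"

definition vcomposable :: "('o, 'a, 't) mode_theory \<Rightarrow> 't \<Rightarrow> 't \<Rightarrow> bool" where
  "vcomposable M \<beta> \<alpha> \<longleftrightarrow>
     \<beta> \<in> transformations M \<and> \<alpha> \<in> transformations M \<and> dom_tr M \<beta> = cod_tr M \<alpha>"

definition hcomposable :: "('o, 'a, 't) mode_theory \<Rightarrow> 't \<Rightarrow> 't \<Rightarrow> bool" where
  "hcomposable M \<alpha> \<beta> \<longleftrightarrow>
     \<alpha> \<in> transformations M \<and> \<beta> \<in> transformations M \<and> composable M (dom_tr M \<alpha>) (dom_tr M \<beta>)"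

locale strict_2_category =
  fixes M :: "('o, 'a, 't) mode_theory" (structure)
  assumes modality_modes: "modality M \<mu> n m \<Longrightarrow> n \<in> modes M \<and> m \<in> modes M"
    and id_mod: "m \<in> modes M \<Longrightarrow> modality M (id_mod M m) m m"
    and comp_mod: "modality M \<mu> n m \<Longrightarrow> modality M \<nu> k n \<Longrightarrow> modality M (\<mu> \<odot> \<nu>) k m"
    and comp_mod_id_left: "modality M \<mu> n m \<Longrightarrow> id_mod M m \<odot> \<mu> = \<mu>"
    and comp_mod_id_right: "modality M \<mu> n m \<Longrightarrow> \<mu> \<odot> id_mod M n = \<mu>"
    and comp_mod_assoc:
      "modality M \<mu> n m \<Longrightarrow> modality M \<nu> k n \<Longrightarrow> modality M \<theta> l k \<Longrightarrow>
       (\<mu> \<odot> \<nu>) \<odot> \<theta> = \<mu> \<odot> (\<nu> \<odot> \<theta>)"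
    and transformation_parallel:
      "transformation M \<alpha> \<mu> \<nu> \<Longrightarrow> \<exists>n m. modality M \<mu> n m \<and> modality M \<nu> n m"
    and id_tr: "\<mu> \<in> modalities M \<Longrightarrow> transformation M (id_tr M \<mu>) \<mu> \<mu>"
    and vcomp:
      "transformation M \<beta> \<nu> \<xi> \<Longrightarrow> transformation M \<alpha> \<mu> \<nu> \<Longrightarrow> transformation M (\<beta> \<cdot> \<alpha>) \<mu> \<xi>"
    and vcomp_id_left: "transformation M \<alpha> \<mu> \<nu> \<Longrightarrow> id_tr M \<nu> \<cdot> \<alpha> = \<alpha>"
    and vcomp_id_right: "transformation M \<alpha> \<mu> \<nu> \<Longrightarrow> \<alpha> \<cdot> id_tr M \<mu> = \<alpha>"
    and vcomp_assoc:
      "transformation M \<gamma> \<xi> \<theta> \<Longrightarrow> transformation M \<beta> \<nu> \<xi> \<Longrightarrow> transformation M \<alpha> \<mu> \<nu> \<Longrightarrow>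
       (\<gamma> \<cdot> \<beta>) \<cdot> \<alpha> = \<gamma> \<cdot> (\<beta> \<cdot> \<alpha>)"
    and hcomp:
      "transformation M \<alpha> \<mu> \<nu> \<Longrightarrow> transformation M \<beta> \<theta> \<xi> \<Longrightarrow> composable M \<mu> \<theta> \<Longrightarrow>
       transformation M (\<alpha> \<star> \<beta>) (\<mu> \<odot> \<theta>) (\<nu> \<odot> \<xi>)"
    and hcomp_id_left:
      "transformation M \<alpha> \<mu> \<nu> \<Longrightarrow> modality M \<mu> n m \<Longrightarrow> id_tr M (id_mod M m) \<star> \<alpha> = \<alpha>"
    and hcomp_id_right:
      "transformation M \<alpha> \<mu> \<nu> \<Longrightarrow> modality M \<mu> n m \<Longrightarrow> \<alpha> \<star> id_tr M (id_mod M n) = \<alpha>"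
    and hcomp_assoc:
      "hcomposable M \<alpha> \<beta> \<Longrightarrow> hcomposable M \<beta> \<gamma> \<Longrightarrow> (\<alpha> \<star> \<beta>) \<star> \<gamma> = \<alpha> \<star> (\<beta> \<star> \<gamma>)"
    and hcomp_id_tr: "composable M \<mu> \<nu> \<Longrightarrow> id_tr M \<mu> \<star> id_tr M \<nu> = id_tr M (\<mu> \<odot> \<nu>)"
    and interchange:
      "vcomposable M \<beta> \<alpha> \<Longrightarrow> vcomposable M \<delta> \<gamma> \<Longrightarrow> hcomposable M \<alpha> \<gamma> \<Longrightarrow>
       (\<beta> \<cdot> \<alpha>) \<star> (\<delta> \<cdot> \<gamma>) = (\<beta> \<star> \<delta>) \<cdot> (\<alpha> \<star> \<gamma>)"

text \<open>\<open>Fun \<mu> A B\<close> is $(\mu \mid A) \to B$ and \<open>Modal \<mu> A\<close> is $\langle \mu \mid A \rangle$.\<close>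

datatype 'a ty =
    Atom nat
  | Bot
  | Top
  | Sum "'a ty" "'a ty"
  | Prod "'a ty" "'a ty"
  | Fun 'a "'a ty" "'a ty"
  | Modal 'a "'a ty"

inductive is_type :: "('o, 'a, 't) mode_theory \<Rightarrow> 'a ty \<Rightarrow> 'o \<Rightarrow> bool" for M where
  type_atom: "m \<in> modes M \<Longrightarrow> is_type M (Atom i) m"
| type_bot: "m \<in> modes M \<Longrightarrow> is_type M Bot m"
| type_top: "m \<in> modes M \<Longrightarrow> is_type M Top m"
| type_sum: "is_type M A m \<Longrightarrow> is_type M B m \<Longrightarrow> is_type M (Sum A B) m"
| type_prod: "is_type M A m \<Longrightarrow> is_type M B m \<Longrightarrow> is_type M (Prod A B) m"
| type_fun:
    "modality M \<mu> n m \<Longrightarrow> is_type M A n \<Longrightarrow> is_type M B m \<Longrightarrow> is_type M (Fun \<mu> A B) m"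
| type_modal: "modality M \<mu> n m \<Longrightarrow> is_type M A n \<Longrightarrow> is_type M (Modal \<mu> A) m"

type_synonym name = string

datatype 'a ctx = Emp | Ext "'a ctx" name 'a "'a ty" | Lock "'a ctx" 'a

fun cat :: "'a ctx \<Rightarrow> 'a ctx \<Rightarrow> 'a ctx"  (infixl "\<frown>" 65) where
  "\<Gamma> \<frown> Emp = \<Gamma>"
| "\<Gamma> \<frown> Ext \<Delta> x \<mu> A = Ext (\<Gamma> \<frown> \<Delta>) x \<mu> A"
| "\<Gamma> \<frown> Lock \<Delta> \<mu> = Lock (\<Gamma> \<frown> \<Delta>) \<mu>"

fun vars :: "'a ctx \<Rightarrow> name set" where
  "vars Emp = {}"
| "vars (Ext \<Gamma> x \<mu> A) = insert x (vars \<Gamma>)"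
| "vars (Lock \<Gamma> \<mu>) = vars \<Gamma>"

inductive is_ctx :: "('o, 'a, 't) mode_theory \<Rightarrow> 'a ctx \<Rightarrow> 'o \<Rightarrow> bool" for M where
  ctx_emp: "m \<in> modes M \<Longrightarrow> is_ctx M Emp m"
| ctx_ext:
    "is_ctx M \<Gamma> m \<Longrightarrow> is_type M A n \<Longrightarrow> modality M \<mu> n m \<Longrightarrow> x \<notin> vars \<Gamma> \<Longrightarrow>
     is_ctx M (Ext \<Gamma> x \<mu> A) m"
| ctx_lock: "is_ctx M \<Gamma> m \<Longrightarrow> modality M \<mu> n m \<Longrightarrow> is_ctx M (Lock \<Gamma> \<mu>) n"

text \<open>
  The identification of contexts.  It is relative to a mode because the empty context is a context
  at every mode \<open>k\<close>, whereas \<open>Lock Emp (id_mod M m)\<close> is a context at mode \<open>m\<close> only.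
\<close>

inductive ctx_eq :: "('o, 'a, 't) mode_theory \<Rightarrow> 'o \<Rightarrow> 'a ctx \<Rightarrow> 'a ctx \<Rightarrow> bool" for M where
  eq_lock_id: "is_ctx M \<Gamma> m \<Longrightarrow> ctx_eq M m (Lock \<Gamma> (id_mod M m)) \<Gamma>"
| eq_lock_comp:
    "is_ctx M \<Gamma> m \<Longrightarrow> modality M \<mu> n m \<Longrightarrow> modality M \<nu> k n \<Longrightarrow>
     ctx_eq M k (Lock (Lock \<Gamma> \<mu>) \<nu>) (Lock \<Gamma> (\<mu> \<odot>\<^bsub>M\<^esub> \<nu>))"
| eq_refl: "is_ctx M \<Gamma> m \<Longrightarrow> ctx_eq M m \<Gamma> \<Gamma>"
| eq_sym: "ctx_eq M m \<Gamma> \<Gamma>' \<Longrightarrow> ctx_eq M m \<Gamma>' \<Gamma>"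
| eq_trans: "ctx_eq M m \<Gamma> \<Gamma>' \<Longrightarrow> ctx_eq M m \<Gamma>' \<Gamma>'' \<Longrightarrow> ctx_eq M m \<Gamma> \<Gamma>''"
| eq_ext:
    "ctx_eq M m \<Gamma> \<Gamma>' \<Longrightarrow> is_type M A n \<Longrightarrow> modality M \<mu> n m \<Longrightarrow> x \<notin> vars \<Gamma> \<Longrightarrow>
     ctx_eq M m (Ext \<Gamma> x \<mu> A) (Ext \<Gamma>' x \<mu> A)"
| eq_lock: "ctx_eq M m \<Gamma> \<Gamma>' \<Longrightarrow> modality M \<mu> n m \<Longrightarrow> ctx_eq M n (Lock \<Gamma> \<mu>) (Lock \<Gamma>' \<mu>)"

text \<open>
  \<open>locks M m \<Gamma>\<close> is $|\Gamma|$ for a context (segment) \<open>\<Gamma>\<close> that starts at mode \<open>m\<close>, so that the empty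
  composite is the identity on \<open>m\<close>.  It is \<open>None\<close> if the locks do not compose.
\<close>

fun locks :: "('o, 'a, 't) mode_theory \<Rightarrow> 'o \<Rightarrow> 'a ctx \<Rightarrow> 'a option" where
  "locks M m Emp = (if m \<in> modes M then Some (id_mod M m) else None)"
| "locks M m (Ext \<Gamma> x \<mu> A) = locks M m \<Gamma>"
| "locks M m (Lock \<Gamma> \<mu>) =
     (case locks M m \<Gamma> of
        None \<Rightarrow> None
      | Some \<kappa> \<Rightarrow> if composable M \<kappa> \<mu> then Some (\<kappa> \<odot>\<^bsub>M\<^esub> \<mu>) else None)"

text \<open>
  Terms modulo renaming of bound variables, in locally nameless form: free variables are names,
  bound ones are de Bruijn indices, and both carry a 2-cell.  The binders \<open>lam\<close>, \<open>case_of\<close> and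
  \<open>let_mod\<close> below take a name and abstract it, so that, for \<open>t\<close> and \<open>u\<close> without dangling
  indices, \<open>lam x t = lam y u\<close> holds iff $\lambda x.t$ and $\lambda y.u$ are equal up to renaming.  All later definitions build terms only
  by means of \<open>FVar\<close>, the non-binding constructors and these three binders; terms with dangling
  indices are therefore never typable.
\<close>

datatype ('a, 't) trm =
    FVar name 't
  | BVar nat 't
  | Pair "('a, 't) trm" "('a, 't) trm"
  | Proj1 "('a, 't) trm"
  | Proj2 "('a, 't) trm"
  | Lam "('a, 't) trm"
  | App "('a, 't) trm" 'a "('a, 't) trm"
  | In1 "('a, 't) trm"
  | In2 "('a, 't) trm"
  | Case "('a, 't) trm" "('a, 't) trm" "('a, 't) trm"
  | Mod 'a "('a, 't) trm"
  | Let 'a 'a "('a, 't) trm" "('a, 't) trm"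

primrec close :: "nat \<Rightarrow> name \<Rightarrow> ('a, 't) trm \<Rightarrow> ('a, 't) trm" where
  "close k x (FVar y \<alpha>) = (if y = x then BVar k \<alpha> else FVar y \<alpha>)"
| "close k x (BVar i \<alpha>) = BVar i \<alpha>"
| "close k x (Pair t u) = Pair (close k x t) (close k x u)"
| "close k x (Proj1 t) = Proj1 (close k x t)"
| "close k x (Proj2 t) = Proj2 (close k x t)"
| "close k x (Lam t) = Lam (close (Suc k) x t)"
| "close k x (App t \<mu> u) = App (close k x t) \<mu> (close k x u)"
| "close k x (In1 t) = In1 (close k x t)"
| "close k x (In2 t) = In2 (close k x t)"
| "close k x (Case t p q) = Case (close k x t) (close (Suc k) x p) (close (Suc k) x q)"
| "close k x (Mod \<mu> t) = Mod \<mu> (close k x t)"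
| "close k x (Let \<mu> \<nu> t u) = Let \<mu> \<nu> (close k x t) (close (Suc k) x u)"

definition lam :: "name \<Rightarrow> ('a, 't) trm \<Rightarrow> ('a, 't) trm" where
  "lam x t = Lam (close 0 x t)"

definition case_of ::
    "('a, 't) trm \<Rightarrow> name \<Rightarrow> ('a, 't) trm \<Rightarrow> name \<Rightarrow> ('a, 't) trm \<Rightarrow> ('a, 't) trm" where
  "case_of t x p y q = Case t (close 0 x p) (close 0 y q)"

text \<open>\<open>let_mod \<mu> \<nu> x t u\<close> is $\mathsf{let}_\mu\ \mathsf{mod}_\nu(x) = t\ \mathsf{in}\ u$.\<close>

definition let_mod :: "'a \<Rightarrow> 'a \<Rightarrow> name \<Rightarrow> ('a, 't) trm \<Rightarrow> ('a, 't) trm \<Rightarrow> ('a, 't) trm" where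
  "let_mod \<mu> \<nu> x t u = Let \<mu> \<nu> t (close 0 x u)"

text \<open>
  A judgement \<open>typing M \<Gamma> t A m\<close> presupposes that \<open>\<Gamma>\<close> is a context and \<open>A\<close> a type at mode \<open>m\<close>.  This
  is enforced by the context premise of \<open>t_var\<close> and by the premise on the other summand in
  \<open>t_in1\<close> and \<open>t_in2\<close>; for the remaining rules it is inherited from the premises
  (lemma \<open>typing_wf\<close>).  Rule \<open>t_conv\<close> implements the identification of contexts.
\<close>

inductive typing ::
    "('o, 'a, 't) mode_theory \<Rightarrow> 'a ctx \<Rightarrow> ('a, 't) trm \<Rightarrow> 'a ty \<Rightarrow> 'o \<Rightarrow> bool" for M where
  t_var:
    "is_ctx M (Ext \<Gamma> x \<mu> A \<frown> \<Delta>) n \<Longrightarrow> modality M \<mu> n m \<Longrightarrow> locks M m \<Delta> = Some \<delta> \<Longrightarrow>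
     transformation M \<alpha> \<mu> \<delta> \<Longrightarrow> typing M (Ext \<Gamma> x \<mu> A \<frown> \<Delta>) (FVar x \<alpha>) A n"
| t_pair: "typing M \<Gamma> t A m \<Longrightarrow> typing M \<Gamma> u B m \<Longrightarrow> typing M \<Gamma> (Pair t u) (Prod A B) m"
| t_proj1: "typing M \<Gamma> t (Prod A B) m \<Longrightarrow> typing M \<Gamma> (Proj1 t) A m"
| t_proj2: "typing M \<Gamma> t (Prod A B) m \<Longrightarrow> typing M \<Gamma> (Proj2 t) B m"
| t_lam: "typing M (Ext \<Gamma> x \<mu> A) t B m \<Longrightarrow> typing M \<Gamma> (lam x t) (Fun \<mu> A B) m"
| t_app:
    "modality M \<mu> n m \<Longrightarrow> typing M \<Gamma> t (Fun \<mu> A B) m \<Longrightarrow> typing M (Lock \<Gamma> \<mu>) u A n \<Longrightarrow>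
     typing M \<Gamma> (App t \<mu> u) B m"
| t_in1: "typing M \<Gamma> t A m \<Longrightarrow> is_type M B m \<Longrightarrow> typing M \<Gamma> (In1 t) (Sum A B) m"
| t_in2: "typing M \<Gamma> t B m \<Longrightarrow> is_type M A m \<Longrightarrow> typing M \<Gamma> (In2 t) (Sum A B) m"
| t_case:
    "typing M \<Gamma> t (Sum A B) m \<Longrightarrow> typing M (Ext \<Gamma> x (id_mod M m) A) p C m \<Longrightarrow>
     typing M (Ext \<Gamma> y (id_mod M m) B) q C m \<Longrightarrow> typing M \<Gamma> (case_of t x p y q) C m"
| t_mod:
    "modality M \<mu> n m \<Longrightarrow> typing M (Lock \<Gamma> \<mu>) t A n \<Longrightarrow> typing M \<Gamma> (Mod \<mu> t) (Modal \<mu> A) m"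
| t_let:
    "modality M \<nu> k n \<Longrightarrow> modality M \<mu> n m \<Longrightarrow> typing M (Lock \<Gamma> \<mu>) t (Modal \<nu> A) n \<Longrightarrow>
     typing M (Ext \<Gamma> x (\<mu> \<odot>\<^bsub>M\<^esub> \<nu>) A) u B m \<Longrightarrow> typing M \<Gamma> (let_mod \<mu> \<nu> x t u) B m"
| t_conv: "typing M \<Gamma> t A m \<Longrightarrow> ctx_eq M m \<Gamma> \<Gamma>' \<Longrightarrow> typing M \<Gamma>' t A m"

lemma ctx_mode:
  assumes "strict_2_category M" and "is_ctx M \<Gamma> m"
  shows "m \<in> modes M"
  using assms(2)
  by (induction rule: is_ctx.induct) (auto dest: strict_2_category.modality_modes[OF assms(1)])

lemma ctx_eq_vars: "ctx_eq M m \<Gamma> \<Gamma>' \<Longrightarrow> vars \<Gamma> = vars \<Gamma>'"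
  by (induction rule: ctx_eq.induct) auto

lemma ctx_eq_wf:
  assumes "strict_2_category M" and "ctx_eq M m \<Gamma> \<Gamma>'"
  shows "is_ctx M \<Gamma> m \<and> is_ctx M \<Gamma>' m"
  using assms(2)
proof (induction rule: ctx_eq.induct)
  case (eq_lock_id \<Gamma> m)
  then show ?case
    using ctx_mode[OF assms(1)] strict_2_category.id_mod[OF assms(1)] by (blast intro: ctx_lock)
next
  case (eq_lock_comp \<Gamma> m \<mu> n \<nu> k)
  then show ?case
    using strict_2_category.comp_mod[OF assms(1)] by (blast intro: ctx_lock)
next
  case (eq_ext m \<Gamma> \<Gamma>' A n \<mu> x)
  then show ?case using ctx_eq_vars by (metis ctx_ext)
qed (auto intro: is_ctx.intros)

inductive_cases is_ctx_ExtE: "is_ctx M (Ext \<Gamma> x \<mu> A) m"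
inductive_cases is_ctx_LockE: "is_ctx M (Lock \<Gamma> \<mu>) m"
inductive_cases is_type_SumE: "is_type M (Sum A B) m"
inductive_cases is_type_ProdE: "is_type M (Prod A B) m"
inductive_cases is_type_FunE: "is_type M (Fun \<mu> A B) m"

lemma is_ctx_prefix: "is_ctx M (\<Gamma> \<frown> \<Delta>) n \<Longrightarrow> \<exists>m. is_ctx M \<Gamma> m"
  by (induction \<Delta> arbitrary: n) (auto elim: is_ctx_ExtE is_ctx_LockE)

lemma typing_wf:
  assumes "strict_2_category M" and "typing M \<Gamma> t A m"
  shows "is_ctx M \<Gamma> m \<and> is_type M A m"
  using assms(2)
proof (induction rule: typing.induct)
  case (t_var \<Gamma> x \<mu> A \<Delta> n m \<delta> \<alpha>)
  then show ?case
    using is_ctx_prefix[OF t_var(1)] by (auto elim!: is_ctx_ExtE simp: modality_def)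
next
  case (t_conv \<Gamma> t A m \<Gamma>')
  then show ?case using ctx_eq_wf[OF assms(1)] by blast
qed (auto elim!: is_ctx_ExtE is_ctx_LockE is_type_SumE is_type_ProdE is_type_FunE
     intro: is_type.intros simp: modality_def)

text \<open>
  The graph of the operation $t\{\Gamma,\alpha,\Delta\}$.  A bound variable is taken fresh for \<open>\<Gamma>\<close> and
  \<open>\<Delta>\<close>.  Terms do not record the type (nor, for \<open>lam\<close>, the tag) of a bound variable, so the
  declaration added to \<open>\<Delta>\<close> is left arbitrary there; the result does not depend on it
  (lemma \<open>lock_weak_unique\<close>).  In \<open>lw_left\<close> the segment \<open>\<Gamma>'\<close> starts at the mode \<open>tgt M \<rho>\<close> of the
  declaration of \<open>x\<close>, and \<open>\<Delta>\<close> starts at the common source of the boundary of \<open>\<alpha>\<close>; if \<open>x\<close> is declared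
  repeatedly in \<open>\<Gamma>\<close>, the rightmost declaration counts.
\<close>

inductive lock_weak ::
    "('o, 'a, 't) mode_theory \<Rightarrow> 'a ctx \<Rightarrow> 't \<Rightarrow> 'a ctx \<Rightarrow> ('a, 't) trm \<Rightarrow> ('a, 't) trm \<Rightarrow> bool"
  for M \<Gamma> \<alpha> where
  lw_left:
    "\<Gamma> = Ext \<Gamma>\<^sub>0 x \<rho> A \<frown> \<Gamma>' \<Longrightarrow> x \<notin> vars \<Gamma>' \<Longrightarrow>
     locks M (tgt M \<rho>) \<Gamma>' = Some \<gamma> \<Longrightarrow> locks M (src M (dom_tr M \<alpha>)) \<Delta> = Some \<delta> \<Longrightarrow>
     hcomposable M (id_tr M \<gamma>) \<alpha> \<Longrightarrow> hcomposable M (id_tr M \<gamma> \<star>\<^bsub>M\<^esub> \<alpha>) (id_tr M \<delta>) \<Longrightarrow>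
     vcomposable M (id_tr M \<gamma> \<star>\<^bsub>M\<^esub> \<alpha> \<star>\<^bsub>M\<^esub> id_tr M \<delta>) \<alpha>' \<Longrightarrow>
     lock_weak M \<Gamma> \<alpha> \<Delta> (FVar x \<alpha>') (FVar x ((id_tr M \<gamma> \<star>\<^bsub>M\<^esub> \<alpha> \<star>\<^bsub>M\<^esub> id_tr M \<delta>) \<cdot>\<^bsub>M\<^esub> \<alpha>'))"
| lw_right:
    "\<Delta> = Ext \<Delta>\<^sub>0 x \<rho> A \<frown> \<Delta>' \<Longrightarrow> lock_weak M \<Gamma> \<alpha> \<Delta> (FVar x \<alpha>') (FVar x \<alpha>')"
| lw_pair:
    "lock_weak M \<Gamma> \<alpha> \<Delta> t t' \<Longrightarrow> lock_weak M \<Gamma> \<alpha> \<Delta> u u' \<Longrightarrow>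
     lock_weak M \<Gamma> \<alpha> \<Delta> (Pair t u) (Pair t' u')"
| lw_proj1: "lock_weak M \<Gamma> \<alpha> \<Delta> t t' \<Longrightarrow> lock_weak M \<Gamma> \<alpha> \<Delta> (Proj1 t) (Proj1 t')"
| lw_proj2: "lock_weak M \<Gamma> \<alpha> \<Delta> t t' \<Longrightarrow> lock_weak M \<Gamma> \<alpha> \<Delta> (Proj2 t) (Proj2 t')"
| lw_lam:
    "x \<notin> vars \<Gamma> \<union> vars \<Delta> \<Longrightarrow> lock_weak M \<Gamma> \<alpha> (Ext \<Delta> x \<xi> A) t t' \<Longrightarrow>
     lock_weak M \<Gamma> \<alpha> \<Delta> (lam x t) (lam x t')"
| lw_app:
    "lock_weak M \<Gamma> \<alpha> \<Delta> t t' \<Longrightarrow> lock_weak M \<Gamma> \<alpha> (Lock \<Delta> \<xi>) u u' \<Longrightarrow>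
     lock_weak M \<Gamma> \<alpha> \<Delta> (App t \<xi> u) (App t' \<xi> u')"
| lw_in1: "lock_weak M \<Gamma> \<alpha> \<Delta> t t' \<Longrightarrow> lock_weak M \<Gamma> \<alpha> \<Delta> (In1 t) (In1 t')"
| lw_in2: "lock_weak M \<Gamma> \<alpha> \<Delta> t t' \<Longrightarrow> lock_weak M \<Gamma> \<alpha> \<Delta> (In2 t) (In2 t')"
| lw_case:
    "x \<notin> vars \<Gamma> \<union> vars \<Delta> \<Longrightarrow> y \<notin> vars \<Gamma> \<union> vars \<Delta> \<Longrightarrow> m \<in> modes M \<Longrightarrow>
     lock_weak M \<Gamma> \<alpha> \<Delta> t t' \<Longrightarrow>
     lock_weak M \<Gamma> \<alpha> (Ext \<Delta> x (id_mod M m) A) p p' \<Longrightarrow>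
     lock_weak M \<Gamma> \<alpha> (Ext \<Delta> y (id_mod M m) B) q q' \<Longrightarrow>
     lock_weak M \<Gamma> \<alpha> \<Delta> (case_of t x p y q) (case_of t' x p' y q')"
| lw_mod: "lock_weak M \<Gamma> \<alpha> (Lock \<Delta> \<xi>) t t' \<Longrightarrow> lock_weak M \<Gamma> \<alpha> \<Delta> (Mod \<xi> t) (Mod \<xi> t')"
| lw_let:
    "x \<notin> vars \<Gamma> \<union> vars \<Delta> \<Longrightarrow> composable M \<rho> \<xi> \<Longrightarrow>
     lock_weak M \<Gamma> \<alpha> (Lock \<Delta> \<rho>) t t' \<Longrightarrow>
     lock_weak M \<Gamma> \<alpha> (Ext \<Delta> x (\<rho> \<odot>\<^bsub>M\<^esub> \<xi>) A) u u' \<Longrightarrow>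
     lock_weak M \<Gamma> \<alpha> \<Delta> (let_mod \<rho> \<xi> x t u) (let_mod \<rho> \<xi> x t' u')"

lemma vars_cat [simp]: "vars (\<Gamma> \<frown> \<Delta>) = vars \<Gamma> \<union> vars \<Delta>"
  by (induction \<Delta>) auto

lemma decl_unique:
  assumes "Ext \<Gamma>\<^sub>0 x \<rho> A \<frown> \<Gamma>' = Ext \<Gamma>\<^sub>1 x \<rho>' A' \<frown> \<Gamma>''" and "x \<notin> vars \<Gamma>'" and "x \<notin> vars \<Gamma>''"
  shows "\<rho> = \<rho>' \<and> \<Gamma>' = \<Gamma>''"
  using assms
proof (induction \<Gamma>' arbitrary: \<Gamma>'')
  case Emp
  then show ?case by (cases \<Gamma>'') auto
next
  case (Ext \<Gamma>' y \<mu> B)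
  then show ?case by (cases \<Gamma>'') auto
next
  case (Lock \<Gamma>' \<mu>)
  then show ?case by (cases \<Gamma>'') auto
qed

text \<open>
  The operation only changes the 2-cells at free variables, depending on the locks passed
  on the way to the variable (innermost first) but not on the declarations.
\<close>

primrec retag :: "(name \<Rightarrow> 'a list \<Rightarrow> 't \<Rightarrow> 't) \<Rightarrow> 'a list \<Rightarrow> ('a, 't) trm \<Rightarrow> ('a, 't) trm" where
  "retag f \<kappa> (FVar x \<alpha>) = FVar x (f x \<kappa> \<alpha>)"
| "retag f \<kappa> (BVar i \<alpha>) = BVar i \<alpha>"
| "retag f \<kappa> (Pair t u) = Pair (retag f \<kappa> t) (retag f \<kappa> u)"
| "retag f \<kappa> (Proj1 t) = Proj1 (retag f \<kappa> t)"
| "retag f \<kappa> (Proj2 t) = Proj2 (retag f \<kappa> t)"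
| "retag f \<kappa> (Lam t) = Lam (retag f \<kappa> t)"
| "retag f \<kappa> (App t \<mu> u) = App (retag f \<kappa> t) \<mu> (retag f (\<mu> # \<kappa>) u)"
| "retag f \<kappa> (In1 t) = In1 (retag f \<kappa> t)"
| "retag f \<kappa> (In2 t) = In2 (retag f \<kappa> t)"
| "retag f \<kappa> (Case t p q) = Case (retag f \<kappa> t) (retag f \<kappa> p) (retag f \<kappa> q)"
| "retag f \<kappa> (Mod \<mu> t) = Mod \<mu> (retag f (\<mu> # \<kappa>) t)"
| "retag f \<kappa> (Let \<mu> \<nu> t u) = Let \<mu> \<nu> (retag f (\<mu> # \<kappa>) t) (retag f \<kappa> u)"

fun lock_list :: "'a ctx \<Rightarrow> 'a list" where
  "lock_list Emp = []"
| "lock_list (Ext \<Gamma> x \<mu> A) = lock_list \<Gamma>"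
| "lock_list (Lock \<Gamma> \<mu>) = \<mu> # lock_list \<Gamma>"

lemma locks_lock_list: "lock_list \<Gamma> = lock_list \<Delta> \<Longrightarrow> locks M m \<Gamma> = locks M m \<Delta>"
proof -
  have *: "locks M m \<Gamma> = locks M m (foldr (\<lambda>\<mu> \<Gamma>. Lock \<Gamma> \<mu>) (lock_list \<Gamma>) Emp)" for \<Gamma>
    by (induction \<Gamma>) auto
  show "lock_list \<Gamma> = lock_list \<Delta> \<Longrightarrow> ?thesis" by (simp add: *[of \<Gamma>] *[of \<Delta>])
qed

lemma retag_close:
  "(\<And>\<kappa> \<alpha>. f x \<kappa> \<alpha> = \<alpha>) \<Longrightarrow> retag f \<kappa> (close k x t) = close k x (retag f \<kappa> t)"
  by (induction t arbitrary: k \<kappa>) auto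

lemma lock_weak_unique:
  assumes "vars \<Gamma> \<inter> vars \<Delta> = {}" and "lock_weak M \<Gamma> \<alpha> \<Delta> t t'" and "lock_weak M \<Gamma> \<alpha> \<Delta> t t''"
  shows "t' = t''"
proof -
  define f where "f x \<kappa> \<alpha>' = (if x \<in> vars \<Gamma> then
      SOME \<beta>. \<exists>\<Delta>. lock_list \<Delta> = \<kappa> \<and> x \<notin> vars \<Delta> \<and> lock_weak M \<Gamma> \<alpha> \<Delta> (FVar x \<alpha>') (FVar x \<beta>)
    else \<alpha>')" for x \<kappa> \<alpha>'
  have fresh: "f x \<kappa> \<alpha>' = \<alpha>'" if "x \<notin> vars \<Gamma>" for x \<kappa> \<alpha>'
    using that by (simp add: f_def)
  have var: "\<beta> = \<beta>'"
    if "lock_weak M \<Gamma> \<alpha> \<Delta> (FVar x \<alpha>') (FVar x \<beta>)" and "x \<notin> vars \<Delta>"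
      and "lock_weak M \<Gamma> \<alpha> \<Delta>' (FVar x \<alpha>') (FVar x \<beta>')" and "x \<notin> vars \<Delta>'"
      and ll: "lock_list \<Delta> = lock_list \<Delta>'" for \<Delta> \<Delta>' x \<alpha>' \<beta> \<beta>'
    using that(1-4) locks_lock_list[OF ll, of M "src M (dom_tr M \<alpha>)"]
    by (auto elim!: lock_weak.cases[of _ _ _ _ "FVar _ _"] simp: lam_def case_of_def let_mod_def
        dest!: decl_unique)
  have "t' = retag f (lock_list \<Delta>) t"
    if "lock_weak M \<Gamma> \<alpha> \<Delta> t t'" and "vars \<Gamma> \<inter> vars \<Delta> = {}" for \<Delta> t t'
    using that
  proof (induction rule: lock_weak.induct)
    case (lw_left \<Gamma>\<^sub>0 x \<rho> A \<Gamma>' \<gamma> \<Delta> \<delta> \<alpha>')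
    let ?\<beta> = "(id_tr M \<gamma> \<star>\<^bsub>M\<^esub> \<alpha> \<star>\<^bsub>M\<^esub> id_tr M \<delta>) \<cdot>\<^bsub>M\<^esub> \<alpha>'"
    have R: "lock_weak M \<Gamma> \<alpha> \<Delta> (FVar x \<alpha>') (FVar x ?\<beta>)"
      using lock_weak.lw_left[OF lw_left(1-7)] .
    have x: "x \<in> vars \<Gamma>" "x \<notin> vars \<Delta>" using lw_left(1,8) by auto
    have "(SOME \<beta>. \<exists>\<Delta>'. lock_list \<Delta>' = lock_list \<Delta> \<and> x \<notin> vars \<Delta>' \<and>
        lock_weak M \<Gamma> \<alpha> \<Delta>' (FVar x \<alpha>') (FVar x \<beta>)) = ?\<beta>"
      by (rule some_equality) (use R x var in blast)+
    then show ?case using x by (simp add: f_def)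
  next
    case (lw_right \<Delta> \<Delta>\<^sub>0 x \<rho> A \<Delta>' \<alpha>')
    then show ?case using fresh by auto
  qed (auto simp: lam_def case_of_def let_mod_def fresh retag_close)
  then show ?thesis using assms by blast
qed

definition lock_weakening ::
    "('o, 'a, 't) mode_theory \<Rightarrow> ('a, 't) trm \<Rightarrow> 'a ctx \<Rightarrow> 't \<Rightarrow> 'a ctx \<Rightarrow> ('a, 't) trm option"
  where
  "lock_weakening M t \<Gamma> \<alpha> \<Delta> =
     (if \<alpha> \<in> transformations M \<and> vars \<Gamma> \<inter> vars \<Delta> = {} \<and> (\<exists>t'. lock_weak M \<Gamma> \<alpha> \<Delta> t t')
      then Some (THE t'. lock_weak M \<Gamma> \<alpha> \<Delta> t t') else None)"

end

theory Submission
  imports Defs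
begin

text \<open>
  A derivation of \<open>Lock \<Gamma> \<mu> \<frown> \<Delta> \<turnstile> t : A\<close> may use the identification of contexts to merge
  the distinguished lock with its neighbours, so a direct induction loses track of it.  The
  induction therefore runs over derivations in an arbitrary context \<open>\<Theta>\<close> that is identified with
  \<open>Lock \<Gamma> \<mu> \<frown> \<Delta>\<close>, which makes the conversion rule trivial.  The price is paid at the variables:
  one needs that the declarations of a context, together with the composite of the locks to their
  right, are invariant under the identification.  If \<open>x : (\<rho> | A)\<close> is found in \<open>\<Gamma>\<close>, the composite is
  \<open>|\<Gamma>'| \<circ> \<mu> \<circ> |\<Delta>|\<close>, and the operation postcomposes the 2-cell of \<open>x\<close> with the whiskering of \<open>\<alpha>\<close>.
\<close>

section \<open>Splitting a context at a declaration\<close>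

lemma Ext_cat_eq_Ext:
  "Ext \<Gamma>\<^sub>0 x \<mu> A \<frown> \<Delta> = Ext \<Gamma> y \<nu> B \<longleftrightarrow>
     \<Delta> = Emp \<and> \<Gamma>\<^sub>0 = \<Gamma> \<and> x = y \<and> \<mu> = \<nu> \<and> A = B \<or>
     (\<exists>\<Delta>'. \<Delta> = Ext \<Delta>' y \<nu> B \<and> Ext \<Gamma>\<^sub>0 x \<mu> A \<frown> \<Delta>' = \<Gamma>)"
  by (cases \<Delta>) auto

lemma Ext_cat_eq_Lock:
  "Ext \<Gamma>\<^sub>0 x \<mu> A \<frown> \<Delta> = Lock \<Gamma> \<nu> \<longleftrightarrow> (\<exists>\<Delta>'. \<Delta> = Lock \<Delta>' \<nu> \<and> Ext \<Gamma>\<^sub>0 x \<mu> A \<frown> \<Delta>' = \<Gamma>)"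
  by (cases \<Delta>) auto

text \<open>A declaration lies either to the right or to the left of the distinguished lock. The two
  alternatives match the clauses \<open>lw_right\<close> and \<open>lw_left\<close>.\<close>

lemma Ext_cat_eq_Lock_catE:
  assumes "Ext \<Gamma>\<^sub>0 x \<rho> A \<frown> \<Theta> = Lock \<Gamma> \<mu> \<frown> \<Delta>"
  obtains (right) \<Delta>\<^sub>0 where "\<Delta> = Ext \<Delta>\<^sub>0 x \<rho> A \<frown> \<Theta>"
  | (left) \<Gamma>' where "\<Gamma> = Ext \<Gamma>\<^sub>0 x \<rho> A \<frown> \<Gamma>'" "\<Theta> = Lock \<Gamma>' \<mu> \<frown> \<Delta>"
proof -
  have "(\<exists>\<Delta>\<^sub>0. \<Delta> = Ext \<Delta>\<^sub>0 x \<rho> A \<frown> \<Theta>) \<or>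
      (\<exists>\<Gamma>'. \<Gamma> = Ext \<Gamma>\<^sub>0 x \<rho> A \<frown> \<Gamma>' \<and> \<Theta> = Lock \<Gamma>' \<mu> \<frown> \<Delta>)"
    using assms
  proof (induction \<Delta> arbitrary: \<Theta>)
    case Emp
    then show ?case by (auto simp: Ext_cat_eq_Lock)
  next
    case (Ext \<Delta> y \<xi> B)
    from Ext.prems have "\<Theta> = Emp \<and> x = y \<and> \<rho> = \<xi> \<and> A = B \<or>
        (\<exists>\<Theta>'. \<Theta> = Ext \<Theta>' y \<xi> B \<and> Ext \<Gamma>\<^sub>0 x \<rho> A \<frown> \<Theta>' = Lock \<Gamma> \<mu> \<frown> \<Delta>)"
      by (auto simp: Ext_cat_eq_Ext)
    then show ?case using Ext.IH by fastforce
  next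
    case (Lock \<Delta> \<xi>)
    from Lock.prems obtain \<Theta>' where "\<Theta> = Lock \<Theta>' \<xi>" "Ext \<Gamma>\<^sub>0 x \<rho> A \<frown> \<Theta>' = Lock \<Gamma> \<mu> \<frown> \<Delta>"
      by (auto simp: Ext_cat_eq_Lock)
    then show ?case using Lock.IH by fastforce
  qed
  then show ?thesis using that by blast
qed

section \<open>Declarations and the locks to their right\<close>

text \<open>This is what \<open>t_var\<close> reads off a context. The split itself is hidden
  because the identification of contexts may change both of its parts, but not the composite of the
  locks right of the declaration.\<close>

definition declared ::
    "('o, 'a, 't) mode_theory \<Rightarrow> 'a ctx \<Rightarrow> name \<Rightarrow> 'a \<Rightarrow> 'a ty \<Rightarrow> 'a \<Rightarrow> bool" where
  "declared M \<Gamma> x \<mu> A \<delta> \<longleftrightarrow>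
     (\<exists>\<Gamma>\<^sub>0 \<Delta>. \<Gamma> = Ext \<Gamma>\<^sub>0 x \<mu> A \<frown> \<Delta> \<and> locks M (tgt M \<mu>) \<Delta> = Some \<delta>)"

lemma declared_Ext:
  "declared M (Ext \<Gamma> y \<nu> B) x \<mu> A \<delta> \<longleftrightarrow>
     y = x \<and> \<nu> = \<mu> \<and> B = A \<and> tgt M \<mu> \<in> modes M \<and> \<delta> = id_mod M (tgt M \<mu>) \<or>
     declared M \<Gamma> x \<mu> A \<delta>"
  (is "?L \<longleftrightarrow> ?here \<or> ?there")
proof
  assume ?L
  then obtain \<Gamma>\<^sub>0 \<Delta> where "Ext \<Gamma>\<^sub>0 x \<mu> A \<frown> \<Delta> = Ext \<Gamma> y \<nu> B"
    and loc: "locks M (tgt M \<mu>) \<Delta> = Some \<delta>"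
    by (auto simp: declared_def)
  then consider "\<Delta> = Emp" "x = y" "\<mu> = \<nu>" "A = B"
    | \<Delta>' where "\<Delta> = Ext \<Delta>' y \<nu> B" "Ext \<Gamma>\<^sub>0 x \<mu> A \<frown> \<Delta>' = \<Gamma>"
    by (auto simp: Ext_cat_eq_Ext)
  then show "?here \<or> ?there"
    using loc by cases (auto simp: declared_def split: if_splits)
next
  assume "?here \<or> ?there"
  then show ?L
  proof
    assume ?here
    then show ?L unfolding declared_def by (intro exI[of _ \<Gamma>] exI[of _ Emp]) simp
  next
    assume ?there
    then obtain \<Gamma>\<^sub>0 \<Delta> where "\<Gamma> = Ext \<Gamma>\<^sub>0 x \<mu> A \<frown> \<Delta>" "locks M (tgt M \<mu>) \<Delta> = Some \<delta>"
      by (auto simp: declared_def)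
    then show ?L
      unfolding declared_def by (intro exI[of _ \<Gamma>\<^sub>0] exI[of _ "Ext \<Delta> y \<nu> B"]) simp
  qed
qed

text \<open>Together with \<open>declared_Ext\<close> this computes the relation by recursion on the
  context, so that inductions over \<open>is_ctx\<close> and \<open>ctx_eq\<close> need not track
  the split.\<close>

lemma declared_Lock:
  "declared M (Lock \<Gamma> \<nu>) x \<mu> A \<delta> \<longleftrightarrow>
     (\<exists>\<kappa>. declared M \<Gamma> x \<mu> A \<kappa> \<and> composable M \<kappa> \<nu> \<and> \<delta> = \<kappa> \<odot>\<^bsub>M\<^esub> \<nu>)"
proof -
  have "declared M (Lock \<Gamma> \<nu>) x \<mu> A \<delta> \<longleftrightarrow>
      (\<exists>\<Gamma>\<^sub>0 \<Delta>. Ext \<Gamma>\<^sub>0 x \<mu> A \<frown> \<Delta> = Lock \<Gamma> \<nu> \<and> locks M (tgt M \<mu>) \<Delta> = Some \<delta>)"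
    unfolding declared_def by metis
  also have "\<dots> \<longleftrightarrow>
      (\<exists>\<Gamma>\<^sub>0 \<Delta>. Ext \<Gamma>\<^sub>0 x \<mu> A \<frown> \<Delta> = \<Gamma> \<and> locks M (tgt M \<mu>) (Lock \<Delta> \<nu>) = Some \<delta>)"
    unfolding Ext_cat_eq_Lock by metis
  also have "\<dots> \<longleftrightarrow> (\<exists>\<kappa>. declared M \<Gamma> x \<mu> A \<kappa> \<and> composable M \<kappa> \<nu> \<and> \<delta> = \<kappa> \<odot>\<^bsub>M\<^esub> \<nu>)"
    unfolding declared_def by (fastforce split: option.splits if_splits)
  finally show ?thesis .
qed

lemma is_ctx_cat_disjoint: "is_ctx M (\<Gamma> \<frown> \<Delta>) k \<Longrightarrow> vars \<Gamma> \<inter> vars \<Delta> = {}"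
  by (induction \<Delta> arbitrary: k) (auto elim!: is_ctx_ExtE is_ctx_LockE)

text \<open>Well-formedness sees the distinguished lock only through its source and target, which
  parallel modalities share. The result is needed because \<open>t_var\<close> demands a well-formed
  context after the replacement.\<close>

lemma is_ctx_Lock_cat:
  assumes "is_ctx M (Lock \<Gamma> \<mu> \<frown> \<Delta>) k" and "modality M \<mu> n m" and "modality M \<nu> n m"
  shows "is_ctx M (Lock \<Gamma> \<nu> \<frown> \<Delta>) k"
  using assms(1)
proof (induction \<Delta> arbitrary: k)
  case Emp
  then show ?case
    using assms(2,3) by (auto elim!: is_ctx_LockE intro!: ctx_lock simp: modality_def)
qed (auto elim!: is_ctx_ExtE is_ctx_LockE intro: is_ctx.intros)

lemma modality_composable: "modality M \<mu> n m \<Longrightarrow> modality M \<nu> k n \<Longrightarrow> composable M \<mu> \<nu>"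
  by (simp add: composable_def modality_def)

section \<open>Composites of locks and the identification of contexts\<close>

context strict_2_category
begin

lemma locks_modality: "locks M m \<Delta> = Some \<delta> \<Longrightarrow> modality M \<delta> (src M \<delta>) m"
proof (induction \<Delta> arbitrary: \<delta>)
  case (Lock \<Delta> \<nu>)
  then show ?case
    using comp_mod by (fastforce simp: composable_def modality_def split: option.splits if_splits)
qed (auto simp: modality_def split: if_splits dest: id_mod)

text \<open>The composite is multiplicative by the right unit law and associativity. The equivalence
  also covers definedness: it serves both to factor a given composite and to show that a new one
  exists.\<close>

lemma locks_cat:
  assumes "locks M m \<Gamma> = Some \<gamma>" and "modality M \<gamma> n m"
  shows "locks M m (\<Gamma> \<frown> \<Delta>) = Some \<kappa> \<longleftrightarrow>
    (\<exists>\<delta>. locks M n \<Delta> = Some \<delta> \<and> \<kappa> = \<gamma> \<odot> \<delta>)"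
proof (induction \<Delta> arbitrary: \<kappa>)
  case Emp
  then show ?case
    using assms comp_mod_id_right modality_modes by auto
next
  case (Lock \<Delta> \<nu>)
  \<comment> \<open>Composing with \<open>\<gamma>\<close> on the left keeps the source of
    \<open>\<delta>\<close>, and composability with \<open>\<nu>\<close> depends on the left factor
    only through its source.\<close>
  have comp: "composable M (\<gamma> \<odot> \<delta>) \<nu> \<longleftrightarrow> composable M \<delta> \<nu>"
    and assoc: "composable M \<delta> \<nu> \<Longrightarrow> \<gamma> \<odot> \<delta> \<odot> \<nu> = \<gamma> \<odot> (\<delta> \<odot> \<nu>)"
    if "locks M n \<Delta> = Some \<delta>" for \<delta>
  proof -
    note k = locks_modality[OF that]
    show "composable M (\<gamma> \<odot> \<delta>) \<nu> \<longleftrightarrow> composable M \<delta> \<nu>"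
      using comp_mod[OF assms(2) k] k by (auto simp: composable_def modality_def)
    show "\<gamma> \<odot> \<delta> \<odot> \<nu> = \<gamma> \<odot> (\<delta> \<odot> \<nu>)" if "composable M \<delta> \<nu>"
      using comp_mod_assoc[OF assms(2) k] that k by (auto simp: composable_def modality_def)
  qed
  have "locks M m (\<Gamma> \<frown> Lock \<Delta> \<nu>) = Some \<kappa> \<longleftrightarrow>
      (\<exists>\<kappa>'. locks M m (\<Gamma> \<frown> \<Delta>) = Some \<kappa>' \<and> composable M \<kappa>' \<nu> \<and> \<kappa> = \<kappa>' \<odot> \<nu>)"
    by (auto split: option.splits)
  also have "\<dots> \<longleftrightarrow> (\<exists>\<delta>. locks M n \<Delta> = Some \<delta> \<and> composable M \<delta> \<nu> \<and> \<kappa> = \<gamma> \<odot> (\<delta> \<odot> \<nu>))"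
    unfolding Lock.IH using comp assoc by metis
  also have "\<dots> \<longleftrightarrow> (\<exists>\<delta>. locks M n (Lock \<Delta> \<nu>) = Some \<delta> \<and> \<kappa> = \<gamma> \<odot> \<delta>)"
    by (auto split: option.splits)
  finally show ?case .
qed auto

lemma declared_modality:
  "is_ctx M \<Gamma> k \<Longrightarrow> declared M \<Gamma> x \<mu> A \<delta> \<Longrightarrow> modality M \<delta> k (tgt M \<mu>)"
proof (induction arbitrary: \<delta> rule: is_ctx.induct)
  case (ctx_emp m)
  then show ?case by (metis declared_def Un_iff empty_iff insert_iff vars.simps(1,2) vars_cat)
next
  case (ctx_ext \<Gamma> m B n \<nu> y)
  then show ?case by (auto simp: declared_Ext modality_def dest: id_mod)
next
  case (ctx_lock \<Gamma> m \<nu> n)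
  then show ?case by (auto simp: declared_Lock intro: comp_mod)
qed

text \<open>The two generating identifications are absorbed by the right unit law and by
  associativity; \<open>declared_modality\<close> guarantees that the composites exist. The
  congruence rules follow from the recursive description of \<open>declared\<close>.\<close>

lemma ctx_eq_declared:
  "ctx_eq M k \<Gamma> \<Gamma>' \<Longrightarrow> declared M \<Gamma> x \<mu> A \<delta> \<longleftrightarrow> declared M \<Gamma>' x \<mu> A \<delta>"
proof (induction arbitrary: \<delta> rule: ctx_eq.induct)
  case (eq_lock_id \<Gamma> m)
  have m: "modality M (id_mod M m) m m"
    using eq_lock_id ctx_mode[OF strict_2_category_axioms] id_mod by blast
  have "composable M \<kappa> (id_mod M m) \<and> \<kappa> \<odot> id_mod M m = \<kappa>" if "declared M \<Gamma> x \<mu> A \<kappa>" for \<kappa>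
    using declared_modality[OF eq_lock_id that] m
    by (blast intro: comp_mod_id_right modality_composable)
  then show ?case unfolding declared_Lock by metis
next
  case (eq_lock_comp \<Gamma> m \<theta> n \<xi> k)
  have "composable M \<kappa> \<theta> \<and> composable M (\<kappa> \<odot> \<theta>) \<xi> \<and> composable M \<kappa> (\<theta> \<odot> \<xi>) \<and>
      \<kappa> \<odot> \<theta> \<odot> \<xi> = \<kappa> \<odot> (\<theta> \<odot> \<xi>)" if "declared M \<Gamma> x \<mu> A \<kappa>" for \<kappa>
    using declared_modality[OF eq_lock_comp(1) that] eq_lock_comp(2,3)
    by (blast intro: comp_mod comp_mod_assoc modality_composable)
  then show ?case unfolding declared_Lock by metis
qed (auto simp: declared_Ext declared_Lock)

section \<open>Lock weakening of well-typed terms\<close>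

text \<open>The base case of the induction. If \<open>x\<close> is declared right of the lock, the
  composite relevant to it does not involve the lock; if left of it, the whiskered
  \<open>\<alpha>\<close> leads from the old composite to the new one.\<close>

lemma lock_weak_var:
  assumes mu: "modality M \<mu> n m" and nu: "modality M \<nu> n m" and al: "transformation M \<alpha> \<mu> \<nu>"
    and ctx: "is_ctx M (Lock \<Gamma> \<mu> \<frown> \<Delta>) k" and rho: "modality M \<rho> k l"
    and decl: "declared M (Lock \<Gamma> \<mu> \<frown> \<Delta>) x \<rho> A \<kappa>" and be: "transformation M \<beta> \<rho> \<kappa>"
  shows "\<exists>t'. lock_weak M \<Gamma> \<alpha> \<Delta> (FVar x \<beta>) t' \<and> typing M (Lock \<Gamma> \<nu> \<frown> \<Delta>) t' A k"
proof -
  have tgt: "tgt M \<rho> = l" using rho by (simp add: modality_def)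
  have ctx': "is_ctx M (Lock \<Gamma> \<nu> \<frown> \<Delta>) k"
    using is_ctx_Lock_cat[OF ctx mu nu] .
  obtain \<Gamma>\<^sub>0 \<Theta> where eq: "Lock \<Gamma> \<mu> \<frown> \<Delta> = Ext \<Gamma>\<^sub>0 x \<rho> A \<frown> \<Theta>"
    and loc: "locks M l \<Theta> = Some \<kappa>"
    using decl tgt by (auto simp: declared_def)
  from eq[symmetric] show ?thesis
  proof (cases rule: Ext_cat_eq_Lock_catE)
    case (right \<Delta>\<^sub>0)
    have cat: "Lock \<Gamma> \<nu> \<frown> (Ext \<Delta>\<^sub>0 x \<rho> A \<frown> \<Theta>) = Ext (Lock \<Gamma> \<nu> \<frown> \<Delta>\<^sub>0) x \<rho> A \<frown> \<Theta>"
      by (induction \<Theta>) auto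
    \<comment> \<open>\<open>\<Theta>\<close> lies wholly right of the distinguished lock, so its
      composite is still \<open>\<kappa>\<close> and \<open>\<beta>\<close> still fits.\<close>
    have "typing M (Lock \<Gamma> \<nu> \<frown> \<Delta>) (FVar x \<beta>) A k"
      using t_var[OF _ rho loc be, of "Lock \<Gamma> \<nu> \<frown> \<Delta>\<^sub>0" x A] ctx' unfolding right cat by simp
    then show ?thesis by (blast intro: lw_right[OF right])
  next
    case (left \<Gamma>')
    have cat: "\<And>\<xi>. Lock (Ext \<Gamma>\<^sub>0 x \<rho> A \<frown> \<Gamma>') \<xi> \<frown> \<Delta> = Ext \<Gamma>\<^sub>0 x \<rho> A \<frown> (Lock \<Gamma>' \<xi> \<frown> \<Delta>)"
      by (induction \<Delta>) auto
    \<comment> \<open>\<open>lw_left\<close> insists on the rightmost declaration of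
      \<open>x\<close>; in a well-formed context names are distinct.\<close>
    have fresh: "x \<notin> vars \<Gamma>'"
      using ctx is_ctx_cat_disjoint[of M "Ext \<Gamma>\<^sub>0 x \<rho> A" "Lock \<Gamma>' \<mu> \<frown> \<Delta>"] unfolding left cat by auto
    \<comment> \<open>\<open>locks_cat\<close> presupposes a composite for the first segment;
      definedness passes from a segment to its prefixes.\<close>
    have defined: "\<exists>\<gamma>. locks M l (Lock \<Gamma>' \<mu>) = Some \<gamma>"
      using loc unfolding left
      by (induction \<Delta> arbitrary: \<kappa>) (auto split: option.splits)
    then obtain \<gamma> where ga: "locks M l \<Gamma>' = Some \<gamma>" and comp: "composable M \<gamma> \<mu>"
      by (auto split: option.splits if_splits)
    have gam: "modality M \<gamma> m l"
      using locks_modality[OF ga] comp mu by (auto simp: composable_def modality_def)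
    have lock: "locks M l (Lock \<Gamma>' \<xi>) = Some (\<gamma> \<odot> \<xi>)" "modality M (\<gamma> \<odot> \<xi>) n l"
      if "modality M \<xi> n m" for \<xi>
      using ga gam that by (auto intro: comp_mod modality_composable)
    obtain \<delta> where de: "locks M n \<Delta> = Some \<delta>" and ka: "\<kappa> = \<gamma> \<odot> \<mu> \<odot> \<delta>"
      using loc unfolding left locks_cat[OF lock[OF mu]] by blast
    have dem: "modality M \<delta> (src M \<delta>) n" using locks_modality[OF de] .
    have id: "transformation M (id_tr M \<gamma>) \<gamma> \<gamma>" "transformation M (id_tr M \<delta>) \<delta> \<delta>"
      using gam dem id_tr by (auto simp: modality_def)
    have whisker_left: "transformation M (id_tr M \<gamma> \<star> \<alpha>) (\<gamma> \<odot> \<mu>) (\<gamma> \<odot> \<nu>)"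
      using hcomp[OF id(1) al comp] .
    have comp': "composable M (\<gamma> \<odot> \<mu>) \<delta>"
      using modality_composable[OF lock(2)[OF mu] dem] .
    \<comment> \<open>The whiskering starts at \<open>\<kappa>\<close>, where \<open>\<beta>\<close>
      ends, so the vertical composite with \<open>\<beta>\<close> is defined; it ends at the
      composite of the locks after the replacement.\<close>
    have whisker: "transformation M (id_tr M \<gamma> \<star> \<alpha> \<star> id_tr M \<delta>) \<kappa> (\<gamma> \<odot> \<nu> \<odot> \<delta>)"
      using hcomp[OF whisker_left id(2) comp'] ka by simp
    let ?\<beta> = "(id_tr M \<gamma> \<star> \<alpha> \<star> id_tr M \<delta>) \<cdot> \<beta>"
    \<comment> \<open>\<open>lw_left\<close> lets \<open>\<Delta>\<close> start at this mode, so the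
      composite it uses there is the \<open>\<delta>\<close> found above.\<close>
    have src: "src M (dom_tr M \<alpha>) = n" using al mu by (simp add: transformation_def modality_def)
    have "lock_weak M \<Gamma> \<alpha> \<Delta> (FVar x \<beta>) (FVar x ?\<beta>)"
      using al id whisker_left whisker be comp comp' ga de tgt src fresh
      by (intro lw_left[OF left(1)])
        (auto simp: hcomposable_def vcomposable_def transformation_def)
    moreover have "locks M l (Lock \<Gamma>' \<nu> \<frown> \<Delta>) = Some (\<gamma> \<odot> \<nu> \<odot> \<delta>)"
      using locks_cat[OF lock[OF nu]] de by blast
    then have "typing M (Lock \<Gamma> \<nu> \<frown> \<Delta>) (FVar x ?\<beta>) A k"
      using t_var[OF _ rho _ vcomp[OF whisker be]] ctx' unfolding left cat by blast
    ultimately show ?thesis by blast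
  qed
qed

text \<open>\<open>\<Delta>\<close> has to vary because binders and locks passed on the way into the
  term are appended to it, whereas \<open>\<Gamma>\<close> and the distinguished lock stay
  fixed.\<close>

lemma lock_weak_typing:
  assumes mu: "modality M \<mu> n m" and nu: "modality M \<nu> n m" and al: "transformation M \<alpha> \<mu> \<nu>"
    and "typing M \<Theta> t A k" and "ctx_eq M k \<Theta> (Lock \<Gamma> \<mu> \<frown> \<Delta>)"
  shows "\<exists>t'. lock_weak M \<Gamma> \<alpha> \<Delta> t t' \<and> typing M (Lock \<Gamma> \<nu> \<frown> \<Delta>) t' A k"
  using assms(4,5)
proof (induction arbitrary: \<Delta> rule: typing.induct)
  note wf = typing_wf[OF strict_2_category_axioms]
  \<comment> \<open>Typability of the body makes the extended context well-formed, so the binder is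
    fresh for \<open>\<Theta>\<close>, and identified contexts have the same variables. Hence the
    freshness conditions of \<open>lock_weak\<close> hold without renaming.\<close>
  have ext: "x \<notin> vars \<Gamma> \<union> vars \<Delta> \<and> ctx_eq M k (Ext \<Theta> x \<xi> B) (Lock \<Gamma> \<mu> \<frown> Ext \<Delta> x \<xi> B)"
    if "typing M (Ext \<Theta> x \<xi> B) t C k" and "ctx_eq M k \<Theta> (Lock \<Gamma> \<mu> \<frown> \<Delta>)" for x \<xi> B \<Theta> \<Delta> t C k
    using wf[OF that(1)] ctx_eq_vars[OF that(2)] eq_ext[OF that(2)] by (auto elim!: is_ctx_ExtE)
  have lock: "ctx_eq M l (Lock \<Theta> \<xi>) (Lock \<Gamma> \<mu> \<frown> Lock \<Delta> \<xi>)"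
    if "modality M \<xi> l k" and "ctx_eq M k \<Theta> (Lock \<Gamma> \<mu> \<frown> \<Delta>)" for \<xi> \<Theta> \<Delta> l k
    using eq_lock[OF that(2,1)] by simp
  {
    case (t_var \<Theta>\<^sub>0 x \<rho> A \<Theta>' k l \<kappa> \<beta>)
    have "declared M (Ext \<Theta>\<^sub>0 x \<rho> A \<frown> \<Theta>') x \<rho> A \<kappa>"
      using t_var(2,3) by (auto simp: declared_def modality_def)
    then have "declared M (Lock \<Gamma> \<mu> \<frown> \<Delta>) x \<rho> A \<kappa>"
      using ctx_eq_declared[OF t_var.prems] by blast
    moreover have "is_ctx M (Lock \<Gamma> \<mu> \<frown> \<Delta>) k"
      using ctx_eq_wf[OF strict_2_category_axioms t_var.prems] by blast
    ultimately show ?case using lock_weak_var[OF mu nu al] t_var(2,4) by blast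
  next
    case (t_pair \<Theta> t A m u B)
    then show ?case by (meson lw_pair typing.t_pair)
  next
    case (t_proj1 \<Theta> t A B m)
    then show ?case by (meson lw_proj1 typing.t_proj1)
  next
    case (t_proj2 \<Theta> t A B m)
    then show ?case by (meson lw_proj2 typing.t_proj2)
  next
    case (t_lam \<Theta> x \<xi> A t B k)
    note e = ext[OF t_lam.hyps t_lam.prems]
    then obtain t' where "lock_weak M \<Gamma> \<alpha> (Ext \<Delta> x \<xi> A) t t'"
      and "typing M (Ext (Lock \<Gamma> \<nu> \<frown> \<Delta>) x \<xi> A) t' B k"
      using t_lam.IH by fastforce
    then show ?case using e by (blast intro: lw_lam typing.t_lam)
  next
    case (t_app \<xi> l k \<Theta> t A B u)
    obtain t' where "lock_weak M \<Gamma> \<alpha> \<Delta> t t'" and "typing M (Lock \<Gamma> \<nu> \<frown> \<Delta>) t' (Fun \<xi> A B) k"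
      using t_app.IH(1) t_app.prems by blast
    moreover obtain u' where "lock_weak M \<Gamma> \<alpha> (Lock \<Delta> \<xi>) u u'"
      and "typing M (Lock (Lock \<Gamma> \<nu> \<frown> \<Delta>) \<xi>) u' A l"
      using t_app.IH(2)[OF lock[OF t_app.hyps(1) t_app.prems]] by auto
    ultimately show ?case using t_app.hyps(1) by (blast intro: lw_app typing.t_app)
  next
    case (t_in1 \<Theta> t A m B)
    then show ?case by (meson lw_in1 typing.t_in1)
  next
    case (t_in2 \<Theta> t B m A)
    then show ?case by (meson lw_in2 typing.t_in2)
  next
    case (t_case \<Theta> t A B k x p C y q)
    note ex = ext[OF t_case.hyps(2) t_case.prems] and ey = ext[OF t_case.hyps(3) t_case.prems]
    obtain t' where "lock_weak M \<Gamma> \<alpha> \<Delta> t t'" and "typing M (Lock \<Gamma> \<nu> \<frown> \<Delta>) t' (Sum A B) k"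
      using t_case.IH(1) t_case.prems by blast
    moreover obtain p' where "lock_weak M \<Gamma> \<alpha> (Ext \<Delta> x (id_mod M k) A) p p'"
      and "typing M (Ext (Lock \<Gamma> \<nu> \<frown> \<Delta>) x (id_mod M k) A) p' C k"
      using t_case.IH(2) ex by fastforce
    moreover obtain q' where "lock_weak M \<Gamma> \<alpha> (Ext \<Delta> y (id_mod M k) B) q q'"
      and "typing M (Ext (Lock \<Gamma> \<nu> \<frown> \<Delta>) y (id_mod M k) B) q' C k"
      using t_case.IH(3) ey by fastforce
    \<comment> \<open>\<open>lw_case\<close> asks for some mode whose identity tags the branch
      variables; the mode of the judgement serves.\<close>
    moreover have "k \<in> modes M"
      using wf[OF t_case.hyps(1)] ctx_mode[OF strict_2_category_axioms] by blast
    ultimately show ?case using ex ey by (blast intro: lw_case typing.t_case)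
  next
    case (t_mod \<xi> l k \<Theta> t A)
    obtain t' where "lock_weak M \<Gamma> \<alpha> (Lock \<Delta> \<xi>) t t'"
      and "typing M (Lock (Lock \<Gamma> \<nu> \<frown> \<Delta>) \<xi>) t' A l"
      using t_mod.IH[OF lock[OF t_mod.hyps(1) t_mod.prems]] by auto
    then show ?case using t_mod.hyps(1) by (blast intro: lw_mod typing.t_mod)
  next
    case (t_let \<xi> j l \<rho> k \<Theta> t A x u B)
    note e = ext[OF t_let.hyps(4) t_let.prems]
    obtain t' where "lock_weak M \<Gamma> \<alpha> (Lock \<Delta> \<rho>) t t'"
      and "typing M (Lock (Lock \<Gamma> \<nu> \<frown> \<Delta>) \<rho>) t' (Modal \<xi> A) l"
      using t_let.IH(1)[OF lock[OF t_let.hyps(2) t_let.prems]] by auto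
    moreover obtain u' where "lock_weak M \<Gamma> \<alpha> (Ext \<Delta> x (\<rho> \<odot> \<xi>) A) u u'"
      and "typing M (Ext (Lock \<Gamma> \<nu> \<frown> \<Delta>) x (\<rho> \<odot> \<xi>) A) u' B k"
      using t_let.IH(2) e by fastforce
    moreover have "composable M \<rho> \<xi>"
      using modality_composable[OF t_let.hyps(2,1)] .
    ultimately show ?case using e t_let.hyps(1,2) by (blast intro: lw_let typing.t_let)
  next
    case (t_conv \<Theta> t A k \<Theta>')
    then show ?case by (blast intro: eq_trans)
  }
qed

end

theorem theorem5:
  fixes M :: "('o, 'a, 't) mode_theory"
    and \<Gamma> \<Delta> :: "'a ctx" and \<mu> \<nu> :: 'a and \<alpha> :: 't and n m p :: 'o
    and t :: "('a, 't) trm" and A :: "'a ty"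
  assumes "strict_2_category M"
    and "modality M \<mu> n m" and "modality M \<nu> n m"
    and "transformation M \<alpha> \<mu> \<nu>"
    and "typing M (Lock \<Gamma> \<mu> \<frown> \<Delta>) t A p"
  shows "\<exists>t'. lock_weakening M t \<Gamma> \<alpha> \<Delta> = Some t' \<and> typing M (Lock \<Gamma> \<nu> \<frown> \<Delta>) t' A p"
proof -
  have ctx: "is_ctx M (Lock \<Gamma> \<mu> \<frown> \<Delta>) p"
    using typing_wf[OF assms(1,5)] by blast
  have disj: "vars \<Gamma> \<inter> vars \<Delta> = {}"
    using is_ctx_cat_disjoint[OF ctx] by simp
  obtain t' where t': "lock_weak M \<Gamma> \<alpha> \<Delta> t t'" and typing: "typing M (Lock \<Gamma> \<nu> \<frown> \<Delta>) t' A p"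
    using strict_2_category.lock_weak_typing[OF assms eq_refl[OF ctx]] by blast
  \<comment> \<open>The graph is single-valued once the names of \<open>\<Gamma>\<close> and
    \<open>\<Delta>\<close> are disjoint, so the description yields the typed witness.\<close>
  have "(THE t'. lock_weak M \<Gamma> \<alpha> \<Delta> t t') = t'"
    using t' by (rule the_equality) (rule lock_weak_unique[OF disj _ t'])
  then have "lock_weakening M t \<Gamma> \<alpha> \<Delta> = Some t'"
    using assms(4) disj t' by (auto simp: lock_weakening_def transformation_def)
  then show ?thesis using typing by blast
qed

end
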